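(* Let $f\colon I\to I$ be a map with finite critical set $C=\{0=c_1<c_2<\ldots<c_N=1\}$, such that for every $i\in\{1,\ldots,N-1\}$ one of the following holds: (a) there exists $k(i)\in\mathbb{N}$ such that $f^{k(i)}((c_i,c_{i+1}))\cap C\neq\emptyset$, or (b) $f^k|_{[c_i,c_{i+1}]}$ is a homeomorphism onto its image for every $k\in\mathbb{N}$, and there is $\delta(i)>0$ such that $|f^k([c_i,c_{i+1}])|\geq\delta(i)$ for all $k\in\mathbb{N}$. Then $f$ is a long-zigzag map.
   Context: $I=[0,1]$, $\mathbb{N}=\{1,2,\dots\}$, $\mathbb{N}_0=\mathbb{N}\cup\{0\}$. A map $f\colon I\to I$ always means a continuous surjection; $f^n$ is the $n$-th iterate ($f^0=\mathrm{id}$); $|J|$ is the length of an interval $J$. A point $c\in(0,1)$ is a critical point of $f$ if for every open $J\ni c$ the restriction $f|_J$ is not one-to-one. The critical set $C$ consists of all critical points of $f$ together with $0$ and $1$. Long-zigzag: $f\colon I\to I$ is long-zigzag if there exists $\varepsilon>0$ such that for every $n\in\mathbb{N}_0$ and every interval $[a,b]\subset I$ such that $f^n([a,b])=[f^n(a),f^n(b)]$ or $f^n([a,b])=[f^n(b),f^n(a)]$, $f^n(x)\notin\{f^n(a),f^n(b)\}$ for every $x\in(a,b)$, and $|f^n(a)-f^n(b)|<\varepsilon$, the map $f^n$ sends $[a,b]$ homeomorphically onto $f^n([a,b])$. *)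

theory Defs
  imports "HOL-Analysis.Analysis"
begin

text \<open>
  Self-maps of the unit interval are represented by functions on the reals of which only the
  restriction to \<open>{0..1}\<close> matters; all notions below depend on that restriction alone.
\<close>

definition interval_map :: "(real \<Rightarrow> real) \<Rightarrow> bool" where
  "interval_map f \<longleftrightarrow> continuous_on {0..1} f \<and> f ` {0..1} = {0..1}"

definition critical_point :: "(real \<Rightarrow> real) \<Rightarrow> real \<Rightarrow> bool" where
  "critical_point f c \<longleftrightarrow> c \<in> {0<..<1} \<and>
     (\<forall>J. openin (top_of_set {0..1}) J \<and> c \<in> J \<longrightarrow> \<not> inj_on f J)"

definition critical_set :: "(real \<Rightarrow> real) \<Rightarrow> real set" where
  "critical_set f = {c. critical_point f c} \<union> {0, 1}"

definition homeo_onto_image :: "real set \<Rightarrow> (real \<Rightarrow> real) \<Rightarrow> bool" where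
  "homeo_onto_image S h \<longleftrightarrow> (\<exists>g. homeomorphism S (h ` S) h g)"

text \<open>
  Since \<open>{p..q}\<close> is empty for \<open>p > q\<close> while the image of \<open>{a..b}\<close> is not, the disjunction
  on the image says that the image is the closed interval between the two endpoint values.
\<close>

definition long_zigzag :: "(real \<Rightarrow> real) \<Rightarrow> bool" where
  "long_zigzag f \<longleftrightarrow> (\<exists>\<epsilon>>0. \<forall>n a b. a \<le> b \<and> {a..b} \<subseteq> {0..1} \<and>
     ((f ^^ n) ` {a..b} = {(f ^^ n) a..(f ^^ n) b} \<or>
      (f ^^ n) ` {a..b} = {(f ^^ n) b..(f ^^ n) a}) \<and>
     (\<forall>x\<in>{a<..<b}. (f ^^ n) x \<notin> {(f ^^ n) a, (f ^^ n) b}) \<and>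
     \<bar>(f ^^ n) a - (f ^^ n) b\<bar> < \<epsilon>
     \<longrightarrow> homeo_onto_image {a..b} (f ^^ n))"

end

theory Submission
  imports Defs
begin

text \<open>
  Call \<open>g\<close> tight on the segment from \<open>a\<close> to \<open>b\<close> if interior points are mapped strictly between
  \<open>g a\<close> and \<open>g b\<close>; the intervals in the definition of a long-zigzag map are, apart from single
  points, those on which \<open>f ^^ n\<close> is tight. The proof rests on three observations.

  By the intermediate value theorem tightness is inherited by both factors of a composition
  (\<open>tight_comp\<close>): if \<open>f ^^ n\<close> is tight on \<open>[a, b]\<close>, then so are \<open>f ^^ k\<close> on \<open>[a, b]\<close> and
  \<open>f ^^ (n - k)\<close> on the segment between \<open>(f ^^ k) a\<close> and \<open>(f ^^ k) b\<close>.

  A tight \<open>f\<close> cannot turn only once: if there is a critical point strictly inside a tight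
  interval, then there are two (\<open>tight_two_critical_points\<close>), hence the interval contains a whole
  lap \<open>[c\<^sub>i, c\<^sub>i\<^sub>+\<^sub>1]\<close>.

  The width \<open>\<bar>(f ^^ n) a - (f ^^ n) b\<bar>\<close> is at least the length of \<open>(f ^^ n) ` [c\<^sub>i, c\<^sub>i\<^sub>+\<^sub>1]\<close>. For a lap of
  type (b) this is at least \<open>\<delta>(i)\<close>. For a lap of type (a) and \<open>n \<le> k(i)\<close> only finitely many
  nondegenerate images occur; and for \<open>n > k(i)\<close> the critical point in
  \<open>(f ^^ k(i)) ` (c\<^sub>i, c\<^sub>i\<^sub>+\<^sub>1)\<close> lies strictly inside the image segment, on which
  \<open>f ^^ (n - k(i))\<close> is tight, so that one can start over with a smaller exponent. Thus a
  tight interval with a critical point of \<open>f\<close> inside has width bounded below by a uniform constant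
  (\<open>tight_width_bound\<close>), provided that the exponent is positive.

  If \<open>f ^^ n\<close> is tight but not injective on \<open>[a, b]\<close>, this bound applies to the first iterate
  of \<open>[a, b]\<close> on which \<open>f\<close> fails to be injective, with the remaining exponent.
\<close>

section \<open>Tight maps\<close>

text \<open>
  Segments instead of intervals make the notion symmetric in the end points, so that
  orientation-reversing iterates need no separate treatment.
\<close>

definition tight :: "(real \<Rightarrow> real) \<Rightarrow> real \<Rightarrow> real \<Rightarrow> bool" where
  "tight g a b \<longleftrightarrow> a \<noteq> b \<and> (\<forall>x\<in>open_segment a b. g x \<in> open_segment (g a) (g b))"

lemma tight_commute: "tight g a b \<longleftrightarrow> tight g b a"
  unfolding tight_def by (metis open_segment_commute)

lemma tight_ends_neq:
  assumes "tight g a b"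
  shows "g a \<noteq> g b"
proof -
  have "midpoint a b \<in> open_segment a b"
    using assms by (simp add: tight_def)
  then have "g (midpoint a b) \<in> open_segment (g a) (g b)"
    using assms by (auto simp: tight_def)
  then show ?thesis by auto
qed

lemma IVT_open_segment:
  fixes g :: "real \<Rightarrow> real"
  assumes "continuous_on (closed_segment a b) g" and "y \<in> open_segment (g a) (g b)"
  obtains x where "x \<in> open_segment a b" and "g x = y"
proof -
  obtain x where x: "x \<in> closed_segment a b" "g x = y"
    using IVT'_closed_segment_real[OF _ assms(1), of y] assms(2)
    by (auto simp: open_segment_def)
  have "x \<in> open_segment a b"
    using x assms(2) by (auto simp: open_segment_def)
  with x that show thesis by blast
qed

text \<open>
  If \<open>g\<close> overshot one of its end values at an interior point, it would take that value again
  on its way to the other end, and there \<open>h \<circ> g\<close> would take an end value in the interior.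
  Conversely \<open>g\<close> takes every value strictly between \<open>g a\<close> and \<open>g b\<close> at an interior point,
  which transports the bounds on \<open>h \<circ> g\<close> to \<open>h\<close>.
\<close>

lemma tight_comp:
  assumes tight: "tight (h \<circ> g) a b" and cont: "continuous_on (closed_segment a b) g"
  shows "tight g a b" and "tight h (g a) (g b)"
proof -
  have neq: "g x \<noteq> g a \<and> g x \<noteq> g b" if "x \<in> open_segment a b" for x
  proof -
    have "h (g x) \<in> open_segment (h (g a)) (h (g b))"
      using tight that by (simp add: tight_def)
    then show ?thesis by (auto simp: open_segment_def)
  qed
  have ends: "g a \<noteq> g b"
    using tight_ends_neq[OF tight] by auto
  have inside: "g x \<in> open_segment (g a) (g b)" if x: "x \<in> open_segment a b" for x
  proof (rule ccontr)
    assume "g x \<notin> open_segment (g a) (g b)"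
    with neq[OF x] ends
    consider "g a \<in> open_segment (g x) (g b)" | "g b \<in> open_segment (g a) (g x)"
      by (auto simp: open_segment_eq_real_ivl split: if_splits)
    then show False
    proof cases
      case 1
      have "closed_segment x b \<subseteq> closed_segment a b" "open_segment x b \<subseteq> open_segment a b"
        using x by (auto simp: open_segment_eq_real_ivl closed_segment_eq_real_ivl split: if_splits)
      then obtain w where "w \<in> open_segment a b" "g w = g a"
        using IVT_open_segment[OF continuous_on_subset[OF cont] 1] by (metis subsetD)
      then show False using neq by blast
    next
      case 2
      have "closed_segment a x \<subseteq> closed_segment a b" "open_segment a x \<subseteq> open_segment a b"
        using x by (auto simp: open_segment_eq_real_ivl closed_segment_eq_real_ivl split: if_splits)
      then obtain w where "w \<in> open_segment a b" "g w = g b"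
        using IVT_open_segment[OF continuous_on_subset[OF cont] 2] by (metis subsetD)
      then show False using neq by blast
    qed
  qed
  then show "tight g a b"
    using tight by (auto simp: tight_def)
  have "h y \<in> open_segment (h (g a)) (h (g b))" if y: "y \<in> open_segment (g a) (g b)" for y
  proof -
    obtain x where "x \<in> open_segment a b" "g x = y"
      using IVT_open_segment[OF cont y] .
    then show ?thesis using tight by (auto simp: tight_def)
  qed
  then show "tight h (g a) (g b)"
    using ends by (auto simp: tight_def)
qed

lemma tight_image_subset:
  assumes "tight g a b"
  shows "g ` closed_segment a b \<subseteq> closed_segment (g a) (g b)"
proof
  fix y assume "y \<in> g ` closed_segment a b"
  then obtain x where x: "x \<in> closed_segment a b" "y = g x" by blast
  then consider "x = a" | "x = b" | "x \<in> open_segment a b"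
    by (auto simp: open_segment_def)
  then show "y \<in> closed_segment (g a) (g b)"
    using x assms by cases (auto simp: tight_def open_segment_def)
qed

section \<open>Critical points\<close>

text \<open>
  If \<open>f x = f y\<close>, then \<open>f\<close> has an extremum strictly between \<open>x\<close> and \<open>y\<close>, and \<open>f\<close>
  is not injective near an interior extremum.
\<close>

lemma locally_inj_imp_inj_on:
  fixes f :: "real \<Rightarrow> real"
  assumes cont: "continuous_on {a..b} f"
    and loc: "\<And>z. z \<in> {a<..<b} \<Longrightarrow> \<exists>e>0. inj_on f {z - e..z + e}"
  shows "inj_on f {a..b}"
proof (rule linorder_inj_onI')
  fix x y assume xy: "x \<in> {a..b}" "y \<in> {a..b}" "x < y"
  show "f x \<noteq> f y"
  proof
    assume eq: "f x = f y"
    have cont': "continuous_on {x..y} f"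
      using cont xy by (auto intro: continuous_on_subset)
    obtain z where z: "z \<in> {x<..<y}"
      and ext: "(\<forall>w\<in>{x..y}. f w \<le> f z) \<or> (\<forall>w\<in>{x..y}. f z \<le> f w)"
    proof -
      obtain p where p: "p \<in> {x..y}" "\<forall>w\<in>{x..y}. f w \<le> f p"
        using continuous_attains_sup[OF compact_Icc _ cont'] xy by force
      obtain q where q: "q \<in> {x..y}" "\<forall>w\<in>{x..y}. f q \<le> f w"
        using continuous_attains_inf[OF compact_Icc _ cont'] xy by force
      show thesis
      proof (cases "p \<in> {x<..<y} \<or> q \<in> {x<..<y}")
        case True
        with p q that show thesis by blast
      next
        case False
        \<comment> \<open>Both extrema sit at the ends, so that \<open>f\<close> is constant.\<close>
        then have "p = x \<or> p = y" "q = x \<or> q = y" using p(1) q(1) by auto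
        then have fpq: "f p = f x" "f q = f x" using eq by auto
        have mid: "(x + y) / 2 \<in> {x<..<y}" using xy by simp
        then have "f x \<le> f ((x + y) / 2)" using q(2) fpq(2) by force
        then have "\<forall>w\<in>{x..y}. f w \<le> f ((x + y) / 2)"
          using p(2) fpq(1) by fastforce
        with mid that show thesis by blast
      qed
    qed
    obtain e where e: "e > 0" "inj_on f {z - e..z + e}"
      using loc[of z] z xy by auto
    define d where "d = min e (min (z - x) (y - z))"
    have d: "d > 0" "d \<le> e" "{z - d..z + d} \<subseteq> {x..y}"
      using e z by (auto simp: d_def)
    have "inj_on f {z - d..z + d}"
      using e(2) by (rule inj_on_subset) (use d in auto)
    moreover have "continuous_on {z - d..z + d} f"
      using cont' d by (auto intro: continuous_on_subset)
    ultimately have "(f (z - d) < f z \<and> f z < f (z + d)) \<or> (f (z + d) < f z \<and> f z < f (z - d))"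
      using continuous_inj_imp_mono[of "z - d" z "z + d" f] d by auto
    moreover have "z - d \<in> {x..y}" "z + d \<in> {x..y}" using d by auto
    ultimately show False using ext by force
  qed
qed

lemma not_inj_on_imp_critical_point:
  assumes cont: "continuous_on {0..1} f" and sub: "{a..b} \<subseteq> {0..1}"
    and ninj: "\<not> inj_on f {a..b}"
  obtains z where "z \<in> {a<..<b}" and "critical_point f z"
proof (rule ccontr)
  assume no: "\<not> thesis"
  have "inj_on f {a..b}"
  proof (rule locally_inj_imp_inj_on)
    show "continuous_on {a..b} f" using cont sub by (rule continuous_on_subset)
    fix z assume z: "z \<in> {a<..<b}"
    then have z01: "z \<in> {0<..<1}" using sub by auto
    have "\<not> critical_point f z" using z no that by blast
    then obtain J where J: "openin (top_of_set {0..1}) J" "z \<in> J" "inj_on f J"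
      using z01 by (auto simp: critical_point_def)
    then obtain T where T: "open T" "J = {0..1} \<inter> T" by (auto simp: openin_open)
    have "open (T \<inter> {0<..<1})" "z \<in> T \<inter> {0<..<1}" using T J z01 by auto
    then obtain e where e: "e > 0" "cball z e \<subseteq> T \<inter> {0<..<1}"
      using open_contains_cball by metis
    have "{z - e..z + e} \<subseteq> J"
      using e T by (force simp: cball_eq_atLeastAtMost)
    with J(3) e(1) show "\<exists>e>0. inj_on f {z - e..z + e}"
      using inj_on_subset by blast
  qed
  with ninj show False by blast
qed

lemma critical_point_imp_not_inj_on:
  assumes "critical_point f z" and "z \<in> {a<..<b}" and "{a..b} \<subseteq> {0..1}"
  shows "\<not> inj_on f {a..b}"
proof
  assume "inj_on f {a..b}"
  then have "inj_on f {a<..<b}" by (rule inj_on_subset) auto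
  moreover have "{a<..<b} = {0..1} \<inter> {a<..<b}" using assms(3) by auto
  then have "openin (top_of_set {0..1}) {a<..<b}"
    by (metis open_greaterThanLessThan openin_open_Int)
  ultimately show False using assms by (auto simp: critical_point_def)
qed

text \<open>
  A tight map with a single turning point \<open>z\<close> would be monotone on either side of \<open>z\<close>, with the
  same orientation on both sides because \<open>f z\<close> lies between \<open>f a\<close> and \<open>f b\<close>; but then \<open>f\<close> is
  injective and \<open>z\<close> is not critical.
\<close>

lemma tight_two_critical_points:
  assumes cont: "continuous_on {0..1} f" and sub: "{a..b} \<subseteq> {0..1}"
    and tight: "tight f a b" and z: "critical_point f z" "z \<in> {a<..<b}"
  obtains w where "critical_point f w" and "w \<in> {a<..<b}" and "w \<noteq> z"
proof (rule ccontr)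
  assume no: "\<not> thesis"
  have inj: "inj_on f {a..z}" "inj_on f {z..b}"
  proof -
    show "inj_on f {a..z}"
    proof (rule ccontr)
      assume "\<not> inj_on f {a..z}"
      from not_inj_on_imp_critical_point[OF cont _ this] sub z no that
      show False by (smt (verit) atLeastAtMost_iff greaterThanLessThan_iff subset_iff)
    qed
    show "inj_on f {z..b}"
    proof (rule ccontr)
      assume "\<not> inj_on f {z..b}"
      from not_inj_on_imp_critical_point[OF cont _ this] sub z no that
      show False by (smt (verit) atLeastAtMost_iff greaterThanLessThan_iff subset_iff)
    qed
  qed
  have conts: "continuous_on {a..z} f" "continuous_on {z..b} f"
    using cont sub z by (auto intro: continuous_on_subset)
  have "f z \<in> open_segment (f a) (f b)"
    using tight z by (auto simp: tight_def open_segment_eq_real_ivl)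
  then have fz: "(f a < f z \<and> f z < f b) \<or> (f b < f z \<and> f z < f a)"
    by (auto simp: open_segment_eq_real_ivl split: if_splits)
  have left: "(f a < f b \<longrightarrow> f x < f z) \<and> (f b < f a \<longrightarrow> f z < f x)" if "x \<in> {a..<z}" for x
    using continuous_inj_imp_mono[OF _ _ conts(1) inj(1), of x] that fz by (cases "x = a") auto
  have right: "(f a < f b \<longrightarrow> f z < f x) \<and> (f b < f a \<longrightarrow> f x < f z)" if "x \<in> {z<..b}" for x
    using continuous_inj_imp_mono[OF _ _ conts(2) inj(2), of x] that fz by (cases "x = b") auto
  have "inj_on f {a..b}"
  proof (rule linorder_inj_onI')
    fix x y assume xy: "x \<in> {a..b}" "y \<in> {a..b}" "x < y"
    consider "y \<le> z" | "z \<le> x" | "x < z" "z < y" by linarith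
    then show "f x \<noteq> f y"
    proof cases
      case 1
      then show ?thesis using inj(1) xy by (auto dest: inj_onD)
    next
      case 2
      then show ?thesis using inj(2) xy by (auto dest: inj_onD)
    next
      case 3
      then show ?thesis using left[of x] right[of y] xy fz by auto
    qed
  qed
  then show False using critical_point_imp_not_inj_on[OF z sub] by blast
qed

section \<open>Iterates\<close>

lemma interval_map_funpow:
  assumes "interval_map f"
  shows "continuous_on {0..1} (f ^^ n)" and "(f ^^ n) ` {0..1} \<subseteq> {0..1}"
proof (induction n)
  case 0
  { case 1 show ?case by (simp add: id_def) }
  { case 2 show ?case by simp }
next
  case (Suc n)
  { case 1
    have "continuous_on {0..1} (\<lambda>x. f ((f ^^ n) x))"
      by (rule continuous_on_compose2[OF _ Suc]) (use assms in \<open>simp add: interval_map_def\<close>)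
    then show ?case by (simp add: comp_def) }
  { case 2
    have "(f ^^ Suc n) ` {0..1} = f ` ((f ^^ n) ` {0..1})" by (simp add: image_comp)
    also have "\<dots> \<subseteq> f ` {0..1}" using Suc(2) by (rule image_mono)
    finally show ?case using assms by (simp add: interval_map_def) }
qed

lemma funpow_continuous_on:
  assumes "interval_map f" and "S \<subseteq> {0..1}"
  shows "continuous_on S (f ^^ n)"
  using interval_map_funpow(1)[OF assms(1)] assms(2) by (rule continuous_on_subset)

text \<open>
  On an interval of constancy every interior point is critical, so finiteness of the critical
  set prevents such intervals for \<open>f\<close> and, since nondegenerate intervals then have nondegenerate
  images, for its iterates.
\<close>

lemma funpow_not_constant:
  assumes f: "interval_map f" and fin: "finite (critical_set f)"
    and "u < v" and "{u..v} \<subseteq> {0..1}"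
  shows "\<exists>x\<in>{u..v}. \<exists>y\<in>{u..v}. (f ^^ n) x \<noteq> (f ^^ n) y"
  using assms(3,4)
proof (induction n)
  case 0
  then show ?case by (intro bexI[of _ u] bexI[of _ v]) auto
next
  case (Suc n)
  then obtain x y where xy: "x \<in> {u..v}" "y \<in> {u..v}" "(f ^^ n) x < (f ^^ n) y"
    by (metis linorder_neqE_linordered_idom)
  define p q where "p = (f ^^ n) x" and "q = (f ^^ n) y"
  have pq: "p < q" using xy by (simp add: p_def q_def)
  have img: "{p..q} \<subseteq> (f ^^ n) ` {u..v}"
  proof
    fix t assume t: "t \<in> {p..q}"
    have seg: "closed_segment x y \<subseteq> {u..v}"
      using xy by (auto simp: closed_segment_eq_real_ivl split: if_splits)
    have "t \<in> closed_segment ((f ^^ n) x) ((f ^^ n) y)"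
      using t pq by (simp add: p_def q_def closed_segment_eq_real_ivl)
    moreover have "continuous_on (closed_segment x y) (f ^^ n)"
      using seg Suc.prems(2) by (intro funpow_continuous_on[OF f]) blast
    ultimately obtain s where "s \<in> closed_segment x y" "(f ^^ n) s = t"
      using IVT'_closed_segment_real by blast
    with seg show "t \<in> (f ^^ n) ` {u..v}" by blast
  qed
  have pq01: "{p..q} \<subseteq> {0..1}"
    using img Suc.prems(2) interval_map_funpow(2)[OF f, of n] by blast
  show ?case
  proof (rule ccontr)
    assume "\<not> ?case"
    have const: "f s = f t" if st: "s \<in> {p..q}" "t \<in> {p..q}" for s t
    proof -
      obtain x' y' where "x' \<in> {u..v}" "y' \<in> {u..v}" "s = (f ^^ n) x'" "t = (f ^^ n) y'"
        using img st by blast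
      moreover from this \<open>\<not> ?case\<close> have "(f ^^ Suc n) x' = (f ^^ Suc n) y'" by blast
      ultimately show ?thesis by simp
    qed
    have "z \<in> critical_set f" if z: "z \<in> {p<..<q}" for z
    proof (rule ccontr)
      assume "z \<notin> critical_set f"
      then obtain J where J: "openin (top_of_set {0..1}) J" "z \<in> J" "inj_on f J"
        using z pq01 by (auto simp: critical_set_def critical_point_def)
      then obtain T where T: "open T" "J = {0..1} \<inter> T" by (auto simp: openin_open)
      have "open (T \<inter> {p<..<q})" "z \<in> T \<inter> {p<..<q}" using T J z by auto
      then obtain e where e: "e > 0" "cball z e \<subseteq> T \<inter> {p<..<q}"
        using open_contains_cball by metis
      then have "z \<in> T \<inter> {p<..<q}" "z + e \<in> T \<inter> {p<..<q}" by (auto simp: dist_real_def subset_iff)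
      then have "z \<in> J" "z + e \<in> J" "f z = f (z + e)"
        using T pq01 const by auto
      with J(3) e(1) show False by (auto dest: inj_onD)
    qed
    then have "finite {p<..<q}" using fin by (meson finite_subset subsetI)
    with pq show False using infinite_Ioo[of p q] by blast
  qed
qed

section \<open>Width of tight images\<close>

lemma uniform_positive_bound:
  assumes "finite S" and "\<And>i. i \<in> S \<Longrightarrow> \<exists>e>0. \<forall>t. R i t \<longrightarrow> e \<le> (w i t :: real)"
  shows "\<exists>e>0. \<forall>i\<in>S. \<forall>t. R i t \<longrightarrow> e \<le> w i t"
  using assms
proof (induction S rule: finite_induct)
  case empty
  show ?case by (rule exI[of _ 1]) simp
next
  case (insert i S)
  obtain d where d: "d > 0" "\<forall>t. R i t \<longrightarrow> d \<le> w i t" using insert.prems by blast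
  obtain e where e: "e > 0" "\<forall>j\<in>S. \<forall>t. R j t \<longrightarrow> e \<le> w j t"
    using insert by auto
  show ?case
    using d e by (intro exI[of _ "min d e"]) (auto simp: min_le_iff_disj)
qed

text \<open>
  The lap \<open>[u, v]\<close> forces a wide image unless some intermediate image segment has an element
  of the critical set inside; this exception is where the descent on \<open>n\<close> continues. If an iterate
  \<open>f ^^ k\<close> maps a point of \<open>(u, v)\<close> into the critical set, the exception occurs for every
  \<open>n > k\<close>, because tightness keeps the image of that point away from the ends, and the
  finitely many remaining exponents are covered by the minimum of positive lower bounds.
  If all images of the lap are long, there is nothing to descend to, as the image segment
  contains the image of the lap.
\<close>

lemma lap_width_bound:
  assumes f: "interval_map f" and fin: "finite (critical_set f)"
    and uv: "u < v" "{u..v} \<subseteq> {0..1}"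
    and lap: "(\<exists>k\<ge>1. (f ^^ k) ` {u<..<v} \<inter> critical_set f \<noteq> {}) \<or>
      (\<exists>\<delta>>0. \<forall>k\<ge>1. measure lborel ((f ^^ k) ` {u..v}) \<ge> \<delta>)"
  shows "\<exists>e>0. \<forall>n a b.
    1 \<le> n \<and> {a..b} \<subseteq> {0..1} \<and> a < u \<and> v < b \<and> tight (f ^^ n) a b \<and>
    \<not> (\<exists>k\<ge>1. k < n \<and> open_segment ((f ^^ k) a) ((f ^^ k) b) \<inter> critical_set f \<noteq> {})
    \<longrightarrow> e \<le> \<bar>(f ^^ n) a - (f ^^ n) b\<bar>"
  using lap
proof
  assume "\<exists>\<delta>>0. \<forall>k\<ge>1. measure lborel ((f ^^ k) ` {u..v}) \<ge> \<delta>"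
  then obtain \<delta> where \<delta>: "\<delta> > 0" "\<forall>k\<ge>1. measure lborel ((f ^^ k) ` {u..v}) \<ge> \<delta>" by blast
  have "\<delta> \<le> \<bar>(f ^^ n) a - (f ^^ n) b\<bar>"
    if "1 \<le> n" and ab: "a < u" "v < b" "tight (f ^^ n) a b" for n a b
  proof -
    have "compact ((f ^^ n) ` {u..v})"
      using uv by (intro compact_continuous_image funpow_continuous_on[OF f]) auto
    then have meas: "(f ^^ n) ` {u..v} \<in> sets lborel" by (simp add: compact_imp_closed)
    have "{u..v} \<subseteq> closed_segment a b"
      using ab uv by (auto simp: closed_segment_eq_real_ivl)
    then have sub: "(f ^^ n) ` {u..v} \<subseteq> closed_segment ((f ^^ n) a) ((f ^^ n) b)"
      using tight_image_subset[OF ab(3)] by blast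
    have "\<delta> \<le> measure lborel ((f ^^ n) ` {u..v})" using \<delta> that by blast
    also have "\<dots> \<le> measure lborel (closed_segment ((f ^^ n) a) ((f ^^ n) b))"
      using sub meas by (rule measure_mono_fmeasurable)
        (auto simp: closed_segment_eq_real_ivl fmeasurable_def)
    also have "\<dots> = \<bar>(f ^^ n) a - (f ^^ n) b\<bar>"
      by (auto simp: closed_segment_eq_real_ivl)
    finally show ?thesis .
  qed
  with \<delta>(1) show ?thesis by blast
next
  assume "\<exists>k\<ge>1. (f ^^ k) ` {u<..<v} \<inter> critical_set f \<noteq> {}"
  then obtain k z where k: "1 \<le> k" and z: "z \<in> {u<..<v}" "(f ^^ k) z \<in> critical_set f" by blast
  have "\<exists>e>0. \<forall>m\<in>{1..k}. \<forall>t. (case t of (a, b) \<Rightarrow> {u..v} \<subseteq> {a..b} \<and> tight (f ^^ m) a b)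
    \<longrightarrow> e \<le> (case t of (a, b) \<Rightarrow> \<bar>(f ^^ m) a - (f ^^ m) b\<bar>)"
  proof (rule uniform_positive_bound)
    fix m assume "m \<in> {1..k}"
    obtain x y where xy: "x \<in> {u..v}" "y \<in> {u..v}" "(f ^^ m) x \<noteq> (f ^^ m) y"
      using funpow_not_constant[OF f fin uv] by blast
    have "\<bar>(f ^^ m) x - (f ^^ m) y\<bar> \<le> \<bar>(f ^^ m) a - (f ^^ m) b\<bar>"
      if "{u..v} \<subseteq> {a..b}" "tight (f ^^ m) a b" for a b
    proof -
      have "x \<in> closed_segment a b" "y \<in> closed_segment a b"
        using xy that by (auto simp: closed_segment_eq_real_ivl)
      then have "(f ^^ m) x \<in> closed_segment ((f ^^ m) a) ((f ^^ m) b)"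
        "(f ^^ m) y \<in> closed_segment ((f ^^ m) a) ((f ^^ m) b)"
        using tight_image_subset[OF that(2)] by blast+
      then show ?thesis by (auto simp: closed_segment_eq_real_ivl split: if_splits)
    qed
    then show "\<exists>e>0. \<forall>t. (case t of (a, b) \<Rightarrow> {u..v} \<subseteq> {a..b} \<and> tight (f ^^ m) a b)
      \<longrightarrow> e \<le> (case t of (a, b) \<Rightarrow> \<bar>(f ^^ m) a - (f ^^ m) b\<bar>)"
      using xy(3) by (intro exI[of _ "\<bar>(f ^^ m) x - (f ^^ m) y\<bar>"]) auto
  qed simp
  then obtain e where e: "e > 0"
    "\<And>m a b. m \<in> {1..k} \<Longrightarrow> {u..v} \<subseteq> {a..b} \<Longrightarrow> tight (f ^^ m) a b
      \<Longrightarrow> e \<le> \<bar>(f ^^ m) a - (f ^^ m) b\<bar>"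
    by auto
  have "\<exists>j\<ge>1. j < n \<and> open_segment ((f ^^ j) a) ((f ^^ j) b) \<inter> critical_set f \<noteq> {}"
    if n: "k < n" and ab: "{a..b} \<subseteq> {0..1}" "a < u" "v < b" "tight (f ^^ n) a b" for n a b
  proof -
    have "f ^^ n = (f ^^ (n - k)) \<circ> (f ^^ k)"
      using n by (metis funpow_add le_add_diff_inverse2 less_imp_le)
    moreover have "continuous_on (closed_segment a b) (f ^^ k)"
      using ab uv by (intro funpow_continuous_on[OF f]) (auto simp: closed_segment_eq_real_ivl)
    ultimately have "tight (f ^^ k) a b" using tight_comp(1) ab(4) by metis
    moreover have "z \<in> open_segment a b"
      using z ab by (auto simp: open_segment_eq_real_ivl)
    ultimately have "(f ^^ k) z \<in> open_segment ((f ^^ k) a) ((f ^^ k) b)"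
      by (auto simp: tight_def)
    with z(2) k n show ?thesis by blast
  qed
  then have "e \<le> \<bar>(f ^^ n) a - (f ^^ n) b\<bar>"
    if "1 \<le> n" "{a..b} \<subseteq> {0..1}" "a < u" "v < b" "tight (f ^^ n) a b"
      "\<not> (\<exists>k\<ge>1. k < n \<and> open_segment ((f ^^ k) a) ((f ^^ k) b) \<inter> critical_set f \<noteq> {})" for n a b
    using that e(2)[of n a b] by (cases "n \<le> k") (auto simp: not_le)
  with e(1) show ?thesis by blast
qed

lemma two_points_enclose_lap:
  fixes c :: "nat \<Rightarrow> real"
  assumes mono: "strict_mono_on {1..N} c" and "x \<in> c ` {1..N}" "y \<in> c ` {1..N}"
    and "x \<in> {a<..<b}" "y \<in> {a<..<b}" "x \<noteq> y"
  obtains i where "i \<in> {1..N - 1}" "a < c i" "c (i + 1) < b"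
proof -
  obtain p q where p: "p \<in> {1..N}" and q: "q \<in> {1..N}" and pq: "p < q"
    and cpq: "a < c p" "c q < b"
  proof -
    obtain r s where rs: "r \<in> {1..N}" "s \<in> {1..N}" "x = c r" "y = c s" using assms(2,3) by blast
    with assms(6) consider "r < s" | "s < r" by fastforce
    then show thesis using that[of r s] that[of s r] rs assms(4,5) by cases auto
  qed
  have "p + 1 \<in> {1..N}" using p q pq by auto
  then have "c (p + 1) \<le> c q"
    using q pq mono by (cases "p + 1 = q") (auto simp: strict_mono_on_def less_imp_le)
  moreover have "p \<in> {1..N - 1}" using p q pq by auto
  ultimately show thesis using that[of p] cpq by auto
qed

text \<open>
  Strong induction on \<open>n\<close>: the segment contains a lap, and either that lap already has a wide
  image or an intermediate image segment with a smaller exponent again has a critical point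
  inside. The exponent \<open>0\<close> has to be excluded, since there the width is just \<open>\<bar>a - b\<bar>\<close>; the descent
  respects this because it consumes strictly fewer than \<open>n\<close> iterations.
\<close>

lemma tight_width_bound:
  fixes c :: "nat \<Rightarrow> real"
  assumes f: "interval_map f" and fin: "finite (critical_set f)"
    and C: "critical_set f = c ` {1..N}" and mono: "strict_mono_on {1..N} c"
    and laps: "\<And>i. i \<in> {1..N - 1} \<Longrightarrow>
      (\<exists>k\<ge>1. (f ^^ k) ` {c i<..<c (i + 1)} \<inter> critical_set f \<noteq> {}) \<or>
      (\<exists>\<delta>>0. \<forall>k\<ge>1. measure lborel ((f ^^ k) ` {c i..c (i + 1)}) \<ge> \<delta>)"
  obtains e where "e > 0" and "\<And>n a b. 1 \<le> n \<Longrightarrow> closed_segment a b \<subseteq> {0..1} \<Longrightarrow>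
    tight (f ^^ n) a b \<Longrightarrow> open_segment a b \<inter> critical_set f \<noteq> {} \<Longrightarrow>
    e \<le> \<bar>(f ^^ n) a - (f ^^ n) b\<bar>"
proof -
  have C01: "critical_set f \<subseteq> {0..1}"
    by (auto simp: critical_set_def critical_point_def)
  define R where "R i t \<longleftrightarrow> (case t of (n, a, b) \<Rightarrow>
    1 \<le> n \<and> {a..b} \<subseteq> {0..1} \<and> a < c i \<and> c (i + 1) < b \<and> tight (f ^^ n) a b \<and>
    \<not> (\<exists>k\<ge>1. k < n \<and> open_segment ((f ^^ k) a) ((f ^^ k) b) \<inter> critical_set f \<noteq> {}))" for i t
  define w where "w = (\<lambda>(n, a, b). \<bar>(f ^^ n) a - (f ^^ n) b\<bar>)"
  have "\<exists>e>0. \<forall>i\<in>{1..N - 1}. \<forall>t. R i t \<longrightarrow> e \<le> w t"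
  proof (rule uniform_positive_bound)
    fix i assume i: "i \<in> {1..N - 1}"
    then have ii: "i \<in> {1..N}" "i + 1 \<in> {1..N}" by auto
    then have "c i < c (i + 1)" using mono by (auto simp: strict_mono_on_def)
    moreover have "c i \<in> {0..1}" "c (i + 1) \<in> {0..1}" using C C01 ii by blast+
    ultimately show "\<exists>e>0. \<forall>t. R i t \<longrightarrow> e \<le> w t"
      using lap_width_bound[OF f fin _ _ laps[OF i]]
      unfolding R_def w_def by simp
  qed simp
  then obtain e where e: "e > 0" "\<And>i t. i \<in> {1..N - 1} \<Longrightarrow> R i t \<Longrightarrow> e \<le> w t" by blast
  have bound: "e \<le> \<bar>(f ^^ n) a - (f ^^ n) b\<bar>"
    if "1 \<le> n" "closed_segment a b \<subseteq> {0..1}" "tight (f ^^ n) a b"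
      "open_segment a b \<inter> critical_set f \<noteq> {}" for n a b
    using that
  proof (induction n arbitrary: a b rule: less_induct)
    case (less n)
    have ordered: "e \<le> \<bar>(f ^^ n) a - (f ^^ n) b\<bar>"
      if ab: "a < b" "{a..b} \<subseteq> {0..1}" and tight: "tight (f ^^ n) a b"
        and crit: "{a<..<b} \<inter> critical_set f \<noteq> {}" for a b
    proof -
      have split: "tight (f ^^ k) a b \<and> tight (f ^^ (n - k)) ((f ^^ k) a) ((f ^^ k) b)"
        if "k \<le> n" for k
      proof -
        have "f ^^ n = (f ^^ (n - k)) \<circ> (f ^^ k)"
          using that by (metis funpow_add le_add_diff_inverse2)
        moreover have "continuous_on (closed_segment a b) (f ^^ k)"
          using ab by (intro funpow_continuous_on[OF f]) (auto simp: closed_segment_eq_real_ivl)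
        ultimately show ?thesis using tight_comp tight by metis
      qed
      have tight1: "tight f a b" using split[of 1] less.prems(1) by simp
      obtain z where z: "z \<in> {a<..<b}" "z \<in> critical_set f" using crit by blast
      then have "critical_point f z" using ab by (auto simp: critical_set_def)
      then obtain y where y: "critical_point f y" "y \<in> {a<..<b}" "y \<noteq> z"
        using tight_two_critical_points[of f a b z] f ab tight1 z(1)
        by (auto simp: interval_map_def)
      have "y \<in> critical_set f" using y(1) by (simp add: critical_set_def)
      then obtain i where i: "i \<in> {1..N - 1}" "a < c i" "c (i + 1) < b"
        using two_points_enclose_lap[OF mono, of z y a b] y(2,3) z C by metis
      show ?thesis
      proof (cases "\<exists>k\<ge>1. k < n \<and>
          open_segment ((f ^^ k) a) ((f ^^ k) b) \<inter> critical_set f \<noteq> {}")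
        case False
        then have "R i (n, a, b)" using less.prems(1) ab tight i by (auto simp: R_def)
        then show ?thesis using e(2)[OF i(1)] by (force simp: w_def)
      next
        case True
        then obtain k where k: "1 \<le> k" "k < n"
          "open_segment ((f ^^ k) a) ((f ^^ k) b) \<inter> critical_set f \<noteq> {}" by blast
        have "a \<in> {0..1}" "b \<in> {0..1}" using ab by auto
        then have "(f ^^ k) a \<in> {0..1}" "(f ^^ k) b \<in> {0..1}"
          using interval_map_funpow(2)[OF f, of k] by blast+
        then have "closed_segment ((f ^^ k) a) ((f ^^ k) b) \<subseteq> {0..1}"
          by (simp add: closed_segment_subset)
        moreover have "tight (f ^^ (n - k)) ((f ^^ k) a) ((f ^^ k) b)" using split k by simp
        ultimately have "e \<le> \<bar>(f ^^ (n - k)) ((f ^^ k) a) - (f ^^ (n - k)) ((f ^^ k) b)\<bar>"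
          using k less.IH[of "n - k" "(f ^^ k) a" "(f ^^ k) b"] by auto
        moreover have "(f ^^ (n - k)) ((f ^^ k) x) = (f ^^ n) x" for x
          using k(2) by (metis comp_apply funpow_add le_add_diff_inverse2 less_imp_le)
        ultimately show ?thesis by simp
      qed
    qed
    show ?case
    proof (cases "a < b")
      case True
      then show ?thesis using ordered less.prems
        by (simp add: open_segment_eq_real_ivl closed_segment_eq_real_ivl)
    next
      case False
      then have "b < a" using less.prems(3) by (simp add: tight_def)
      then have "e \<le> \<bar>(f ^^ n) b - (f ^^ n) a\<bar>"
        using ordered[of b a] less.prems tight_commute
        by (simp add: open_segment_eq_real_ivl closed_segment_eq_real_ivl)
      then show ?thesis by simp
    qed
  qed
  show thesis using that[OF e(1)] bound by blast
qed

text \<open>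
  The first iterate that destroys injectivity is the one that carries information: on the
  preceding image segment \<open>f\<close> itself is not injective, so a critical point lies inside.
\<close>

lemma tight_not_inj_imp_critical_inside:
  assumes f: "interval_map f" and ab: "a < b" "{a..b} \<subseteq> {0..1}"
    and tight: "tight (f ^^ n) a b" and ninj: "\<not> inj_on (f ^^ n) {a..b}"
  obtains m where "m < n" and "tight (f ^^ (n - m)) ((f ^^ m) a) ((f ^^ m) b)"
    and "open_segment ((f ^^ m) a) ((f ^^ m) b) \<inter> critical_set f \<noteq> {}"
proof -
  have "\<exists>m<n. (\<forall>i\<le>m. inj_on (f ^^ i) {a..b}) \<and> \<not> inj_on (f ^^ Suc m) {a..b}"
    using ex_least_nat_less[of "\<lambda>m. \<not> inj_on (f ^^ m) {a..b}" n] ninj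
    by simp
  then obtain m where m: "m < n" "inj_on (f ^^ m) {a..b}" "\<not> inj_on (f ^^ Suc m) {a..b}"
    by blast
  have seg: "closed_segment a b = {a..b}" using ab by (simp add: closed_segment_eq_real_ivl)
  have "f ^^ n = (f ^^ (n - m)) \<circ> (f ^^ m)"
    using m(1) by (metis funpow_add le_add_diff_inverse2 less_imp_le)
  moreover have "continuous_on (closed_segment a b) (f ^^ m)"
    using ab seg by (simp add: funpow_continuous_on[OF f])
  ultimately have tights: "tight (f ^^ m) a b" "tight (f ^^ (n - m)) ((f ^^ m) a) ((f ^^ m) b)"
    using tight_comp tight by metis+
  let ?p = "min ((f ^^ m) a) ((f ^^ m) b)" and ?q = "max ((f ^^ m) a) ((f ^^ m) b)"
  have cs: "closed_segment ((f ^^ m) a) ((f ^^ m) b) = {?p..?q}"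
    and os: "open_segment ((f ^^ m) a) ((f ^^ m) b) = {?p<..<?q}"
    by (auto simp: closed_segment_eq_real_ivl open_segment_eq_real_ivl)
  have "\<not> inj_on f ((f ^^ m) ` {a..b})"
    using m comp_inj_on[of "f ^^ m" "{a..b}" f] by auto
  moreover have "(f ^^ m) ` {a..b} \<subseteq> {?p..?q}"
    using tight_image_subset[OF tights(1)] seg cs by simp
  ultimately have ninj': "\<not> inj_on f {?p..?q}" using inj_on_subset by blast
  have "a \<in> {0..1}" "b \<in> {0..1}" using ab by auto
  then have "(f ^^ m) a \<in> {0..1}" "(f ^^ m) b \<in> {0..1}"
    using interval_map_funpow(2)[OF f, of m] by blast+
  then have "{?p..?q} \<subseteq> {0..1}" by auto
  then obtain z where "z \<in> {?p<..<?q}" "critical_point f z"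
    using not_inj_on_imp_critical_point[OF _ _ ninj'] f by (auto simp: interval_map_def)
  then have "open_segment ((f ^^ m) a) ((f ^^ m) b) \<inter> critical_set f \<noteq> {}"
    using os by (auto simp: critical_set_def)
  with that m(1) tights(2) show thesis by blast
qed

lemma tight_if_image_between_ends:
  assumes "a < b" and img: "g ` {a..b} = {g a..g b} \<or> g ` {a..b} = {g b..g a}"
    and ends: "\<forall>x\<in>{a<..<b}. g x \<notin> {g a, g b}"
  shows "tight g a b"
proof -
  have "g x \<in> open_segment (g a) (g b)" if x: "x \<in> {a<..<b}" for x
  proof -
    have "g x \<in> g ` {a..b}" using x by auto
    moreover have "g a \<in> g ` {a..b}" using assms(1) by simp
    ultimately have "g x \<in> {g a..g b} \<or> g x \<in> {g b..g a} \<and> g b \<le> g a"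
      using img by force
    then have "g x \<in> closed_segment (g a) (g b)"
      by (auto simp: closed_segment_eq_real_ivl)
    with ends x show ?thesis by (auto simp: open_segment_def)
  qed
  with assms(1) show ?thesis by (simp add: tight_def open_segment_eq_real_ivl)
qed

theorem theorem3p6:
  fixes f :: "real \<Rightarrow> real" and c :: "nat \<Rightarrow> real" and N :: nat
  assumes "interval_map f"
    and "finite (critical_set f)"
    and "critical_set f = c ` {1..N}"
    and "strict_mono_on {1..N} c"
    and "c 1 = 0" and "c N = 1"
    and "\<And>i. i \<in> {1..N - 1} \<Longrightarrow>
      (\<exists>k\<ge>1. (f ^^ k) ` {c i<..<c (i + 1)} \<inter> critical_set f \<noteq> {}) \<or>
      ((\<forall>k\<ge>1. homeo_onto_image {c i..c (i + 1)} (f ^^ k)) \<and>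
       (\<exists>\<delta>>0. \<forall>k\<ge>1. measure lborel ((f ^^ k) ` {c i..c (i + 1)}) \<ge> \<delta>))"
  shows "long_zigzag f"
proof -
  obtain e where e: "e > 0" and bound: "\<And>n a b. 1 \<le> n \<Longrightarrow> closed_segment a b \<subseteq> {0..1} \<Longrightarrow>
    tight (f ^^ n) a b \<Longrightarrow> open_segment a b \<inter> critical_set f \<noteq> {} \<Longrightarrow>
    e \<le> \<bar>(f ^^ n) a - (f ^^ n) b\<bar>"
    using tight_width_bound[OF assms(1-4)] assms(7) by metis
  have "homeo_onto_image {a..b} (f ^^ n)"
    if "a \<le> b" and sub: "{a..b} \<subseteq> {0..1}"
      and img: "(f ^^ n) ` {a..b} = {(f ^^ n) a..(f ^^ n) b} \<or>
        (f ^^ n) ` {a..b} = {(f ^^ n) b..(f ^^ n) a}"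
      and ends: "\<forall>x\<in>{a<..<b}. (f ^^ n) x \<notin> {(f ^^ n) a, (f ^^ n) b}"
      and small: "\<bar>(f ^^ n) a - (f ^^ n) b\<bar> < e" for n a b
  proof -
    have "inj_on (f ^^ n) {a..b}"
    proof (rule ccontr)
      assume ninj: "\<not> inj_on (f ^^ n) {a..b}"
      then have "a < b" using \<open>a \<le> b\<close> by (cases "a = b") auto
      then have "tight (f ^^ n) a b" using tight_if_image_between_ends img ends by blast
      then obtain m where m: "m < n" "tight (f ^^ (n - m)) ((f ^^ m) a) ((f ^^ m) b)"
        "open_segment ((f ^^ m) a) ((f ^^ m) b) \<inter> critical_set f \<noteq> {}"
        using tight_not_inj_imp_critical_inside[OF assms(1) \<open>a < b\<close> sub _ ninj] by blast
      have "a \<in> {0..1}" "b \<in> {0..1}" using \<open>a < b\<close> sub by auto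
      then have "(f ^^ m) a \<in> {0..1}" "(f ^^ m) b \<in> {0..1}"
        using interval_map_funpow(2)[OF assms(1), of m] by blast+
      then have "closed_segment ((f ^^ m) a) ((f ^^ m) b) \<subseteq> {0..1}"
        by (simp add: closed_segment_subset)
      then have "e \<le> \<bar>(f ^^ (n - m)) ((f ^^ m) a) - (f ^^ (n - m)) ((f ^^ m) b)\<bar>"
        using bound m by simp
      moreover have "(f ^^ (n - m)) ((f ^^ m) x) = (f ^^ n) x" for x
        using m(1) by (metis comp_apply funpow_add le_add_diff_inverse2 less_imp_le)
      ultimately show False using small by simp
    qed
    moreover have "continuous_on {a..b} (f ^^ n)"
      using assms(1) sub by (rule funpow_continuous_on)
    ultimately show ?thesis
      unfolding homeo_onto_image_def
      using homeomorphism_compact[OF compact_Icc] by metis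
  qed
  with e show ?thesis unfolding long_zigzag_def by blast
qed

end
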